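(* Let $W$ be the Weyl group of a semisimple algebraic group over an algebraically closed field. Then the set $\underline{W}_m$ of conjugacy classes of $W$ containing a unique element of maximal length is equal to the set of conjugacy classes $C$ of $W$ having a maximum with respect to the Bruhat order (i.e. such that there is $\sigma\in C$ with $\tau\le\sigma$ for all $\tau\in C$).
   Context: Length and Bruhat order on $W$ are taken with respect to the simple reflections associated with a fixed basis of the root system. "Element of maximal length in $C$" means an element of $C$ whose length is maximal among the elements of $C$. *)

theory Defs
  imports "HOL-Analysis.Analysis" "HOL-Algebra.Algebra"
begin

section \<open>Root systems and their Weyl groups\<close>

definition reflection :: "'a::euclidean_space \<Rightarrow> 'a \<Rightarrow> 'a" where
  "reflection \<alpha> x = x - (2 * (x \<bullet> \<alpha>) / (\<alpha> \<bullet> \<alpha>)) *\<^sub>R \<alpha>"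

text \<open>Reduced crystallographic root systems in the Euclidean space \<open>V\<close>, a subspace of the
  ambient type. The subspace is a parameter because a type of class \<^class>\<open>euclidean_space\<close>
  has positive dimension, whereas the root system of the trivial group has rank \<open>0\<close>.\<close>

definition root_system :: "'a::euclidean_space set \<Rightarrow> 'a set \<Rightarrow> bool" where
  "root_system V \<Phi> \<longleftrightarrow>
     finite \<Phi> \<and> span \<Phi> = V \<and> 0 \<notin> \<Phi> \<and>
     (\<forall>\<alpha>\<in>\<Phi>. reflection \<alpha> ` \<Phi> = \<Phi>) \<and>
     (\<forall>\<alpha>\<in>\<Phi>. \<forall>\<beta>\<in>\<Phi>. 2 * (\<beta> \<bullet> \<alpha>) / (\<alpha> \<bullet> \<alpha>) \<in> \<int>) \<and>
     (\<forall>\<alpha>\<in>\<Phi>. \<forall>c. c *\<^sub>R \<alpha> \<in> \<Phi> \<longrightarrow> c = 1 \<or> c = - 1)"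

definition root_basis :: "'a::euclidean_space set \<Rightarrow> 'a set \<Rightarrow> 'a set \<Rightarrow> bool" where
  "root_basis V \<Phi> \<Delta> \<longleftrightarrow>
     \<Delta> \<subseteq> \<Phi> \<and> independent \<Delta> \<and> span \<Delta> = V \<and>
     (\<forall>\<beta>\<in>\<Phi>. \<exists>c :: 'a \<Rightarrow> int.
        \<beta> = (\<Sum>\<alpha>\<in>\<Delta>. of_int (c \<alpha>) *\<^sub>R \<alpha>) \<and>
        ((\<forall>\<alpha>\<in>\<Delta>. c \<alpha> \<ge> 0) \<or> (\<forall>\<alpha>\<in>\<Delta>. c \<alpha> \<le> 0)))"

text \<open>The elements are maps on the whole ambient space. They fix the orthogonal complement of
  \<open>span \<Phi>\<close> pointwise, so restriction to \<open>span \<Phi>\<close> identifies this group with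
  the Weyl group acting on \<open>span \<Phi>\<close>.\<close>

definition weyl_group :: "'a::euclidean_space set \<Rightarrow> ('a \<Rightarrow> 'a) monoid" where
  "weyl_group \<Phi> =
     (BijGroup UNIV)\<lparr>carrier := generate (BijGroup UNIV) (reflection ` \<Phi>)\<rparr>"

definition simple_reflections :: "'a::euclidean_space set \<Rightarrow> ('a \<Rightarrow> 'a) set" where
  "simple_reflections \<Delta> = reflection ` \<Delta>"

section \<open>Conjugacy classes, length and Bruhat order\<close>

text \<open>The orbits of the action in \<open>group.action_by_conjugation\<close>.\<close>

definition conjugacy_classes :: "('g, 'm) monoid_scheme \<Rightarrow> 'g set set" where
  "conjugacy_classes G =
     orbits G (carrier G) (\<lambda>g. \<lambda>h\<in>carrier G. g \<otimes>\<^bsub>G\<^esub> h \<otimes>\<^bsub>G\<^esub> inv\<^bsub>G\<^esub> g)"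

definition word_length :: "('g, 'm) monoid_scheme \<Rightarrow> 'g set \<Rightarrow> 'g \<Rightarrow> nat" where
  "word_length G S w =
     (LEAST n. \<exists>ss. length ss = n \<and> set ss \<subseteq> S \<and> foldr (\<otimes>\<^bsub>G\<^esub>) ss \<one>\<^bsub>G\<^esub> = w)"

definition all_reflections :: "('g, 'm) monoid_scheme \<Rightarrow> 'g set \<Rightarrow> 'g set" where
  "all_reflections G S = {g \<otimes>\<^bsub>G\<^esub> s \<otimes>\<^bsub>G\<^esub> inv\<^bsub>G\<^esub> g | g s. g \<in> carrier G \<and> s \<in> S}"

definition bruhat_le :: "('g, 'm) monoid_scheme \<Rightarrow> 'g set \<Rightarrow> 'g \<Rightarrow> 'g \<Rightarrow> bool" where
  "bruhat_le G S =
     (\<lambda>u v. u \<in> carrier G \<and>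
        (\<exists>t\<in>all_reflections G S. v = t \<otimes>\<^bsub>G\<^esub> u) \<and>
        word_length G S u < word_length G S v)\<^sup>*\<^sup>*"

definition classes_with_unique_longest ::
  "('g, 'm) monoid_scheme \<Rightarrow> 'g set \<Rightarrow> 'g set set" where
  "classes_with_unique_longest G S =
     {C \<in> conjugacy_classes G. \<exists>!\<sigma>. is_arg_max (word_length G S) (\<lambda>\<tau>. \<tau> \<in> C) \<sigma>}"

definition classes_with_bruhat_maximum ::
  "('g, 'm) monoid_scheme \<Rightarrow> 'g set \<Rightarrow> 'g set set" where
  "classes_with_bruhat_maximum G S =
     {C \<in> conjugacy_classes G. \<exists>\<sigma>\<in>C. \<forall>\<tau>\<in>C. bruhat_le G S \<tau> \<sigma>}"

end

theory Submission
  imports Defs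
begin

text \<open>
  Let \<open>\<sigma>\<close> be the unique longest element of \<open>C\<close> and \<open>\<alpha>\<close> a simple root with \<open>\<sigma> \<alpha> > 0\<close>. Conjugation by
  the reflection in \<open>\<alpha>\<close> does not decrease the length of \<open>\<sigma>\<close>, so it fixes \<open>\<sigma>\<close>, which means
  \<open>\<sigma> \<alpha> = \<alpha>\<close>. Comparing coordinates outside the set of fixed simple roots, every positive root
  is either fixed by \<open>\<sigma>\<close> or made negative. Hence \<open>\<sigma>\<^sup>2\<close> has no inversions, and \<open>C\<close> consists of
  involutions.

  Let \<open>\<tau> \<in> C\<close>. If some simple \<open>\<alpha>\<close> has \<open>\<tau> \<alpha> > 0\<close> and \<open>\<tau> \<alpha> \<noteq> \<alpha>\<close>, then \<open>\<tau> < s \<tau> < s \<tau> s\<close> for the reflection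
  \<open>s\<close> in \<open>\<alpha>\<close>, because \<open>\<tau>\<close> is its own inverse, and one continues from \<open>s \<tau> s \<in> C\<close>. Otherwise the
  inversions of \<open>\<tau>\<close>, like those of \<open>\<sigma>\<close>, are exactly the positive roots it does not fix. Conjugate
  elements fix equally many roots, so \<open>\<tau>\<close> is as long as \<open>\<sigma>\<close> and therefore equals it.
\<close>

section \<open>Reflections and words in them\<close>

lemma reflection_zero [simp]: "reflection 0 x = x"
  by (simp add: reflection_def)

text \<open>Division by zero yields 0, which makes \<open>reflection 0\<close> the identity, so no
  hypothesis \<open>\<alpha> \<noteq> 0\<close> is called for.\<close>

lemma orthogonal_transformation_reflection: "orthogonal_transformation (reflection \<alpha>)"
proof (cases "\<alpha> = 0")
  case False
  have "linear (reflection \<alpha>)"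
    by (rule linearI)
      (simp_all add: reflection_def inner_add_left algebra_simps add_divide_distrib)
  moreover have "reflection \<alpha> v \<bullet> reflection \<alpha> w = v \<bullet> w" for v w
    using False by (simp add: reflection_def inner_diff_left inner_diff_right inner_commute field_simps)
  ultimately show ?thesis
    by (simp add: orthogonal_transformation_def)
next
  case True
  then have "reflection \<alpha> = (\<lambda>x. x)"
    by (simp add: fun_eq_iff)
  then show ?thesis
    by simp
qed

lemma linear_reflection: "linear (reflection \<alpha>)"
  using orthogonal_transformation_reflection orthogonal_transformation_def by blast

lemma reflection_self: "reflection \<alpha> \<alpha> = - \<alpha>"
  by (cases "\<alpha> = 0") (simp_all add: reflection_def scaleR_2)

lemma reflection_invol [simp]: "reflection \<alpha> (reflection \<alpha> x) = x"
  by (cases "\<alpha> = 0") (simp_all add: reflection_def inner_diff_left field_simps flip: scaleR_add_left)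

lemma reflection_comp_self [simp]: "reflection \<alpha> \<circ> reflection \<alpha> = id"
  by (simp add: fun_eq_iff)

lemma reflection_uminus: "reflection (- \<alpha>) = reflection \<alpha>"
  by (simp add: fun_eq_iff reflection_def)

text \<open>An isometry carries the mirror of \<alpha> to the mirror of \<open>w \<alpha>\<close>.
  Writing the conjugation as a commutation rule avoids the inverse of \<open>w\<close>.\<close>

lemma orthogonal_transformation_comp_reflection:
  assumes "orthogonal_transformation w"
  shows "w \<circ> reflection \<alpha> = reflection (w \<alpha>) \<circ> w"
proof -
  have "linear w" "\<And>x y. w x \<bullet> w y = x \<bullet> y"
    using assms by (auto simp: orthogonal_transformation_def)
  then show ?thesis
    by (simp add: fun_eq_iff reflection_def linear_diff linear_scale)
qed

text \<open>The letters are vectors rather than reflections, so that a letter can be compared with a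
  root, as the exchange argument requires.\<close>

definition reflection_word :: "'a::euclidean_space list \<Rightarrow> 'a \<Rightarrow> 'a" where
  "reflection_word \<alpha>s = foldr (\<lambda>\<alpha> f. reflection \<alpha> \<circ> f) \<alpha>s id"

lemma reflection_word_Nil [simp]: "reflection_word [] = id"
  and reflection_word_Cons [simp]:
    "reflection_word (\<alpha> # \<alpha>s) = reflection \<alpha> \<circ> reflection_word \<alpha>s"
  by (simp_all add: reflection_word_def)

lemma reflection_word_append [simp]:
  "reflection_word (\<alpha>s @ \<beta>s) = reflection_word \<alpha>s \<circ> reflection_word \<beta>s"
  by (induction \<alpha>s) (simp_all add: comp_assoc)

lemma orthogonal_transformation_word: "orthogonal_transformation (reflection_word \<alpha>s)"
proof (induction \<alpha>s)
  case (Cons \<alpha> \<alpha>s)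
  then show ?case
    unfolding reflection_word_Cons
    by (intro orthogonal_transformation_compose orthogonal_transformation_reflection)
qed (simp add: id_def)

section \<open>The ambient group of bijections\<close>

lemma carrier_BijGroup_UNIV: "carrier (BijGroup UNIV) = {f :: 'b \<Rightarrow> 'b. bij f}"
  by (auto simp: BijGroup_def Bij_def)

lemma mult_BijGroup_UNIV:
  "bij f \<Longrightarrow> bij g \<Longrightarrow> f \<otimes>\<^bsub>BijGroup UNIV\<^esub> g = f \<circ> (g :: 'b \<Rightarrow> 'b)"
  by (simp add: BijGroup_def Bij_def compose_def fun_eq_iff)

lemma one_BijGroup_UNIV: "\<one>\<^bsub>BijGroup UNIV\<^esub> = (id :: 'b \<Rightarrow> 'b)"
  by (simp add: BijGroup_def fun_eq_iff)

lemma bij_word: "bij (reflection_word \<alpha>s)"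
  using orthogonal_transformation_bij orthogonal_transformation_word by blast

lemma bij_reflection: "bij (reflection \<alpha>)"
  using orthogonal_transformation_bij orthogonal_transformation_reflection by blast

lemma inv_BijGroup_reflection:
  "inv\<^bsub>BijGroup UNIV\<^esub> (reflection \<alpha>) = reflection (\<alpha> :: 'b :: euclidean_space)"
  by (rule group.inv_equality[OF group_BijGroup])
    (simp_all add: carrier_BijGroup_UNIV bij_reflection mult_BijGroup_UNIV one_BijGroup_UNIV)

section \<open>Coordinates in a basis and positive roots\<close>

locale based_root_system =
  fixes V \<Phi> \<Delta> :: "'a::euclidean_space set"
  assumes root_system: "root_system V \<Phi>"
    and root_basis: "root_basis V \<Phi> \<Delta>"
begin

abbreviation coord :: "'a \<Rightarrow> 'a \<Rightarrow> real" where
  "coord \<equiv> representation \<Delta>"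

definition pos_roots :: "'a set" where
  "pos_roots = {\<beta> \<in> \<Phi>. \<forall>\<alpha>\<in>\<Delta>. coord \<beta> \<alpha> \<ge> 0}"

lemma finite_roots: "finite \<Phi>"
  and zero_not_root: "0 \<notin> \<Phi>"
  and reflection_roots: "\<alpha> \<in> \<Phi> \<Longrightarrow> reflection \<alpha> ` \<Phi> = \<Phi>"
  and reduced: "\<alpha> \<in> \<Phi> \<Longrightarrow> c *\<^sub>R \<alpha> \<in> \<Phi> \<Longrightarrow> c = 1 \<or> c = - 1"
  using root_system by (auto simp: root_system_def)

lemma simple_roots: "\<Delta> \<subseteq> \<Phi>"
  and independent: "independent \<Delta>"
  using root_basis by (auto simp: root_basis_def)

lemma roots_span: "\<Phi> \<subseteq> span \<Delta>"
  using root_system root_basis span_superset by (auto simp: root_system_def root_basis_def)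

lemma finite_simple: "finite \<Delta>"
  using finite_roots simple_roots finite_subset by blast

lemma sum_coord: "\<beta> \<in> \<Phi> \<Longrightarrow> (\<Sum>\<alpha>\<in>\<Delta>. coord \<beta> \<alpha> *\<^sub>R \<alpha>) = \<beta>"
  using roots_span by (intro real_vector.sum_representation_eq independent finite_simple) auto

lemma coord_uminus: "\<beta> \<in> \<Phi> \<Longrightarrow> coord (- \<beta>) \<alpha> = - coord \<beta> \<alpha>"
  using real_vector.representation_neg[OF independent] roots_span by auto

lemma coord_simple: "\<alpha> \<in> \<Delta> \<Longrightarrow> coord \<alpha> \<beta> = (if \<beta> = \<alpha> then 1 else 0)"
  by (simp add: real_vector.representation_basis[OF independent])

lemma coord_sum:
  "A \<subseteq> \<Phi> \<Longrightarrow> coord (\<Sum>\<beta>\<in>A. c \<beta> *\<^sub>R \<beta>) \<alpha> = (\<Sum>\<beta>\<in>A. c \<beta> * coord \<beta> \<alpha>)"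
  using roots_span
  by (subst real_vector.representation_sum[OF independent])
    (auto simp: real_vector.representation_scale[OF independent] span_scale subset_iff
      intro!: sum.cong)

lemma uminus_root: "\<beta> \<in> \<Phi> \<Longrightarrow> - \<beta> \<in> \<Phi>"
  using reflection_roots[of \<beta>] reflection_self[of \<beta>] by (metis imageI)

text \<open>By linear independence the integer coefficients supplied by \<open>root_basis\<close>
  are the coordinates, so their common sign carries over.\<close>

lemma coord_sign:
  assumes "\<beta> \<in> \<Phi>"
  shows "(\<forall>\<alpha>\<in>\<Delta>. coord \<beta> \<alpha> \<ge> 0) \<or> (\<forall>\<alpha>\<in>\<Delta>. coord \<beta> \<alpha> \<le> 0)"
proof -
  obtain c :: "'a \<Rightarrow> int" where c: "\<beta> = (\<Sum>\<alpha>\<in>\<Delta>. of_int (c \<alpha>) *\<^sub>R \<alpha>)"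
    "(\<forall>\<alpha>\<in>\<Delta>. c \<alpha> \<ge> 0) \<or> (\<forall>\<alpha>\<in>\<Delta>. c \<alpha> \<le> 0)"
    using root_basis assms unfolding root_basis_def by blast
  have "coord \<beta> \<alpha> = c \<alpha>" if "\<alpha> \<in> \<Delta>" for \<alpha>
  proof -
    have "coord \<beta> \<alpha> = (\<Sum>\<gamma>\<in>\<Delta>. of_int (c \<gamma>) * coord \<gamma> \<alpha>)"
      unfolding c(1) by (rule coord_sum[OF simple_roots])
    also have "\<dots> = (\<Sum>\<gamma>\<in>\<Delta>. if \<alpha> = \<gamma> then of_int (c \<gamma>) else 0)"
      by (intro sum.cong) (auto simp: coord_simple)
    finally show ?thesis
      using that finite_simple by simp
  qed
  then show ?thesis
    using c(2) by auto
qed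

lemma pos_roots_subset: "\<beta> \<in> pos_roots \<Longrightarrow> \<beta> \<in> \<Phi>"
  by (simp add: pos_roots_def)

lemma simple_pos: "\<alpha> \<in> \<Delta> \<Longrightarrow> \<alpha> \<in> pos_roots"
  using simple_roots by (auto simp: pos_roots_def coord_simple)

lemma finite_pos_roots: "finite pos_roots"
  using finite_roots by (simp add: pos_roots_def)

text \<open>As all coordinates of a root share a sign, a single positive one settles
  positivity.\<close>

lemma pos_coord_witness:
  assumes "\<beta> \<in> \<Phi>" "\<alpha> \<in> \<Delta>" "coord \<beta> \<alpha> > 0"
  shows "\<beta> \<in> pos_roots"
  using assms coord_sign[OF assms(1)] by (force simp: pos_roots_def)

lemma uminus_pos_iff:
  assumes "\<beta> \<in> \<Phi>"
  shows "- \<beta> \<in> pos_roots \<longleftrightarrow> \<beta> \<notin> pos_roots"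
proof -
  obtain \<gamma> where \<gamma>: "\<gamma> \<in> \<Delta>" "coord \<beta> \<gamma> \<noteq> 0"
  proof (rule ccontr)
    assume "\<not> thesis"
    then have "\<forall>\<gamma>\<in>\<Delta>. coord \<beta> \<gamma> = 0"
      using that by blast
    then have "\<beta> = 0"
      using sum_coord[OF assms] by simp
    then show False
      using assms zero_not_root by simp
  qed
  have neg: "- \<beta> \<in> pos_roots \<longleftrightarrow> (\<forall>\<alpha>\<in>\<Delta>. coord \<beta> \<alpha> \<le> 0)"
    by (simp add: pos_roots_def coord_uminus[OF assms] uminus_root[OF assms])
  have pos: "\<beta> \<in> pos_roots \<longleftrightarrow> (\<forall>\<alpha>\<in>\<Delta>. coord \<beta> \<alpha> \<ge> 0)"
    by (simp add: pos_roots_def assms)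
  show ?thesis
    unfolding neg pos using coord_sign[OF assms] \<gamma> by (meson order_antisym)
qed

lemma uminus_simple_not_pos: "\<alpha> \<in> \<Delta> \<Longrightarrow> - \<alpha> \<notin> pos_roots"
  by (simp add: uminus_pos_iff simple_pos pos_roots_subset)

text \<open>A positive root supported on \<alpha> alone would be a multiple of \<alpha>, hence
  \<alpha> or \<open>- \<alpha>\<close> because the system is reduced, and its nonnegative
  coordinates leave only \<alpha>.\<close>

lemma pos_root_other_coord:
  assumes "\<beta> \<in> pos_roots" "\<alpha> \<in> \<Delta>" "\<beta> \<noteq> \<alpha>"
  shows "\<exists>\<gamma>\<in>\<Delta>. \<gamma> \<noteq> \<alpha> \<and> coord \<beta> \<gamma> > 0"
proof (rule ccontr)
  assume contra: "\<not> ?thesis"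
  have \<beta>: "\<beta> \<in> \<Phi>"
    using assms(1) by (rule pos_roots_subset)
  have "coord \<beta> \<gamma> = 0" if "\<gamma> \<in> \<Delta>" "\<gamma> \<noteq> \<alpha>" for \<gamma>
  proof (rule ccontr)
    assume "coord \<beta> \<gamma> \<noteq> 0"
    moreover have "coord \<beta> \<gamma> \<ge> 0"
      using assms(1) that(1) by (simp add: pos_roots_def)
    ultimately show False
      using contra that by (metis order_less_le)
  qed
  then have "(\<Sum>\<gamma>\<in>\<Delta>. coord \<beta> \<gamma> *\<^sub>R \<gamma>) = (\<Sum>\<gamma>\<in>\<Delta>. if \<alpha> = \<gamma> then coord \<beta> \<gamma> *\<^sub>R \<gamma> else 0)"
    by (intro sum.cong) auto
  then have eq: "\<beta> = coord \<beta> \<alpha> *\<^sub>R \<alpha>"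
    using sum_coord[OF \<beta>] assms(2) finite_simple by simp
  then have "coord \<beta> \<alpha> = 1 \<or> coord \<beta> \<alpha> = - 1"
    using reduced[of \<alpha> "coord \<beta> \<alpha>"] \<beta> simple_roots assms(2) by auto
  moreover have "coord \<beta> \<alpha> \<ge> 0"
    using assms by (simp add: pos_roots_def)
  ultimately show False
    using eq assms(3) by simp
qed

lemma coord_reflection_simple:
  assumes "\<beta> \<in> \<Phi>" "\<alpha> \<in> \<Delta>"
  shows "coord (reflection \<alpha> \<beta>) \<gamma> =
    coord \<beta> \<gamma> - (if \<gamma> = \<alpha> then 2 * (\<beta> \<bullet> \<alpha>) / (\<alpha> \<bullet> \<alpha>) else 0)"
  unfolding reflection_def using assms roots_span
  by (subst real_vector.representation_diff[OF independent])
    (auto simp: span_scale span_base coord_simple real_vector.representation_scale[OF independent])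

lemma reflection_root: "\<alpha> \<in> \<Delta> \<Longrightarrow> \<beta> \<in> \<Phi> \<Longrightarrow> reflection \<alpha> \<beta> \<in> \<Phi>"
  using reflection_roots[of \<alpha>] simple_roots by blast

text \<open>The reflection alters only the coordinate at \<alpha>, so a positive coordinate at
  another simple root survives and certifies positivity.\<close>

lemma reflection_pos:
  assumes "\<alpha> \<in> \<Delta>" "\<beta> \<in> pos_roots" "\<beta> \<noteq> \<alpha>"
  shows "reflection \<alpha> \<beta> \<in> pos_roots"
proof -
  obtain \<gamma> where "\<gamma> \<in> \<Delta>" "\<gamma> \<noteq> \<alpha>" "coord \<beta> \<gamma> > 0"
    using pos_root_other_coord assms by metis
  moreover have "\<beta> \<in> \<Phi>"
    using assms(2) by (rule pos_roots_subset)
  ultimately show ?thesis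
    using assms coord_reflection_simple[of \<beta> \<alpha> \<gamma>]
    by (intro pos_coord_witness[of _ \<gamma>] reflection_root) auto
qed

lemma reflection_pos_iff:
  assumes "\<alpha> \<in> \<Delta>" "\<beta> \<in> \<Phi>"
  shows "reflection \<alpha> \<beta> \<in> pos_roots \<longleftrightarrow> (\<beta> \<in> pos_roots \<and> \<beta> \<noteq> \<alpha>) \<or> \<beta> = - \<alpha>"
proof -
  have lin: "reflection \<alpha> (- \<beta>) = - reflection \<alpha> \<beta>"
    using linear_reflection linear_neg by blast
  have self: "- \<alpha> \<notin> pos_roots" "\<alpha> \<in> pos_roots"
    using assms(1) by (auto intro: simple_pos dest: uminus_simple_not_pos)
  show ?thesis
  proof (cases "\<beta> \<in> pos_roots")
    case True
    then show ?thesis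
      using reflection_pos[OF assms(1) True] self reflection_self[of \<alpha>] by auto
  next
    case False
    then have "- \<beta> \<in> pos_roots"
      using uminus_pos_iff assms(2) by blast
    then have "- \<beta> \<noteq> \<alpha> \<Longrightarrow> - reflection \<alpha> \<beta> \<in> pos_roots"
      using reflection_pos[OF assms(1)] lin by metis
    moreover have "- \<beta> = \<alpha> \<Longrightarrow> reflection \<alpha> \<beta> = \<alpha>"
      using lin reflection_self[of \<alpha>] by (metis add.inverse_inverse)
    ultimately show ?thesis
      using False self uminus_pos_iff[OF reflection_root[OF assms]]
      by (metis add.inverse_inverse)
  qed
qed

text \<open>Induction on the height, the sum of the coordinates: a simple \<alpha> at an acute angle
  to \<beta> reflects it to a lower positive root, and conjugating back recovers the reflection in
  \<beta>. Heights are real numbers here, so the measure counts the positive roots of smaller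
  height.\<close>

lemma pos_root_reflection_word:
  "\<beta> \<in> pos_roots \<Longrightarrow> \<exists>\<alpha>s\<in>lists \<Delta>. reflection_word \<alpha>s = reflection \<beta>"
proof (induction "card {\<gamma>\<in>pos_roots. sum (coord \<gamma>) \<Delta> < sum (coord \<beta>) \<Delta>}"
    arbitrary: \<beta> rule: less_induct)
  case less
  show ?case
  proof (cases "\<beta> \<in> \<Delta>")
    case True
    then show ?thesis
      by (intro bexI[of _ "[\<beta>]"]) auto
  next
    case False
    have \<beta>: "\<beta> \<in> \<Phi>"
      using less.prems by (rule pos_roots_subset)
    \<comment> \<open>Expanding one factor of the positive number
      \<open>\<beta> \<bullet> \<beta>\<close> in the basis, some summand must be positive; this
      produces \<alpha>.\<close>
    then have "0 < \<beta> \<bullet> \<beta>"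
      using zero_not_root by auto
    also have "\<beta> \<bullet> \<beta> = (\<Sum>\<alpha>\<in>\<Delta>. coord \<beta> \<alpha> * (\<beta> \<bullet> \<alpha>))"
      by (subst (2) sum_coord[OF \<beta>, symmetric]) (simp add: inner_sum_right)
    finally obtain \<alpha> where "\<alpha> \<in> \<Delta>" and "coord \<beta> \<alpha> * (\<beta> \<bullet> \<alpha>) > 0"
      by (meson not_less sum_nonpos)
    moreover have "coord \<beta> \<alpha> \<ge> 0"
      using less.prems \<open>\<alpha> \<in> \<Delta>\<close> by (simp add: pos_roots_def)
    ultimately have \<alpha>: "\<alpha> \<in> \<Delta>" "\<beta> \<bullet> \<alpha> > 0"
      by (auto simp: zero_less_mult_iff)
    let ?\<gamma> = "reflection \<alpha> \<beta>"
    have \<gamma>: "?\<gamma> \<in> pos_roots"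
      using reflection_pos[OF \<alpha>(1) less.prems] False \<alpha>(1) by blast
    have "\<alpha> \<bullet> \<alpha> > 0"
      using \<alpha>(1) zero_not_root simple_roots by auto
    have "sum (coord ?\<gamma>) \<Delta> = sum (coord \<beta>) \<Delta> - 2 * (\<beta> \<bullet> \<alpha>) / (\<alpha> \<bullet> \<alpha>)"
      using \<alpha>(1) finite_simple by (simp add: coord_reflection_simple[OF \<beta> \<alpha>(1)] sum_subtractf)
    also have "\<dots> < sum (coord \<beta>) \<Delta>"
      using \<alpha> \<open>\<alpha> \<bullet> \<alpha> > 0\<close> by simp
    finally have "sum (coord ?\<gamma>) \<Delta> < sum (coord \<beta>) \<Delta>" .
    then have "{\<delta>\<in>pos_roots. sum (coord \<delta>) \<Delta> < sum (coord ?\<gamma>) \<Delta>}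
        \<subset> {\<delta>\<in>pos_roots. sum (coord \<delta>) \<Delta> < sum (coord \<beta>) \<Delta>}"
      using \<gamma> by fastforce
    then have "card {\<delta>\<in>pos_roots. sum (coord \<delta>) \<Delta> < sum (coord ?\<gamma>) \<Delta>}
        < card {\<delta>\<in>pos_roots. sum (coord \<delta>) \<Delta> < sum (coord \<beta>) \<Delta>}"
      using finite_pos_roots by (intro psubset_card_mono) auto
    then obtain \<alpha>s where \<alpha>s: "\<alpha>s \<in> lists \<Delta>" "reflection_word \<alpha>s = reflection ?\<gamma>"
      using less.hyps \<gamma> by blast
    have "reflection \<alpha> \<circ> (reflection ?\<gamma> \<circ> reflection \<alpha>) = reflection \<beta>"
      using orthogonal_transformation_comp_reflection
        [OF orthogonal_transformation_reflection, of \<alpha> ?\<gamma>]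
      by (simp add: fun_eq_iff)
    then show ?thesis
      using \<alpha>s \<alpha>(1) by (intro bexI[of _ "\<alpha> # \<alpha>s @ [\<alpha>]"]) auto
  qed
qed

lemma root_reflection_word:
  assumes "\<beta> \<in> \<Phi>"
  shows "\<exists>\<alpha>s\<in>lists \<Delta>. reflection_word \<alpha>s = reflection \<beta>"
  using pos_root_reflection_word[of \<beta>] pos_root_reflection_word[of "- \<beta>"] uminus_pos_iff[OF assms]
    reflection_uminus[of \<beta>] by auto

section \<open>The Weyl group as words in simple reflections\<close>

abbreviation W :: "('a \<Rightarrow> 'a) monoid" where
  "W \<equiv> weyl_group \<Phi>"

abbreviation len :: "('a \<Rightarrow> 'a) \<Rightarrow> nat" where
  "len \<equiv> word_length W (simple_reflections \<Delta>)"

text \<open>The generators are the reflections in all roots; \<open>root_reflection_word\<close>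
  rewrites each by simple ones. Words without inverses suffice because a reflection is its own
  inverse.\<close>

lemma carrier_weyl: "carrier W = reflection_word ` lists \<Delta>"
proof
  show "carrier W \<subseteq> reflection_word ` lists \<Delta>"
  proof
    fix w
    assume "w \<in> carrier W"
    then have "w \<in> generate (BijGroup UNIV) (reflection ` \<Phi>)"
      by (simp add: weyl_group_def)
    then show "w \<in> reflection_word ` lists \<Delta>"
    proof (induction rule: generate.induct)
      case one
      then show ?case
        by (auto simp: one_BijGroup_UNIV intro!: image_eqI[of _ _ "[]"])
    next
      case (incl h)
      then show ?case
        using root_reflection_word by (force simp: image_iff)
    next
      case (inv h)
      then show ?case
        using root_reflection_word by (force simp: image_iff inv_BijGroup_reflection)
    next
      case (eng h1 h2)
      then obtain \<alpha>s \<beta>s where "\<alpha>s \<in> lists \<Delta>" "\<beta>s \<in> lists \<Delta>"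
        "h1 = reflection_word \<alpha>s" "h2 = reflection_word \<beta>s"
        by blast
      then show ?case
        by (auto simp: mult_BijGroup_UNIV bij_word intro!: image_eqI[of _ _ "\<alpha>s @ \<beta>s"])
    qed
  qed
  have "reflection_word \<alpha>s \<in> carrier W" if "\<alpha>s \<in> lists \<Delta>" for \<alpha>s
    using that
  proof (induction \<alpha>s)
    case Nil
    then show ?case
      using generate.one[of "BijGroup UNIV" "reflection ` \<Phi>"]
      by (simp add: weyl_group_def one_BijGroup_UNIV id_def)
  next
    case (Cons \<alpha> \<alpha>s)
    then have "reflection \<alpha> \<in> generate (BijGroup UNIV) (reflection ` \<Phi>)"
      using simple_roots by (auto intro!: generate.incl)
    then have "reflection \<alpha> \<otimes>\<^bsub>BijGroup UNIV\<^esub> reflection_word \<alpha>s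
        \<in> generate (BijGroup UNIV) (reflection ` \<Phi>)"
      using Cons.IH by (auto simp: weyl_group_def intro!: generate.eng)
    then show ?case
      unfolding mult_BijGroup_UNIV[OF bij_reflection bij_word] by (simp add: weyl_group_def comp_def)
  qed
  then show "reflection_word ` lists \<Delta> \<subseteq> carrier W"
    by blast
qed

lemma weyl_bij: "w \<in> carrier W \<Longrightarrow> bij w"
  and weyl_orthogonal: "w \<in> carrier W \<Longrightarrow> orthogonal_transformation w"
  by (auto simp: carrier_weyl bij_word orthogonal_transformation_word)

lemma weyl_linear: "w \<in> carrier W \<Longrightarrow> linear w"
  by (rule orthogonal_transformation_linear[OF weyl_orthogonal])

lemma weyl_mult: "v \<in> carrier W \<Longrightarrow> w \<in> carrier W \<Longrightarrow> v \<otimes>\<^bsub>W\<^esub> w = v \<circ> w"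
  using mult_BijGroup_UNIV[OF weyl_bij weyl_bij, of v w] by (simp add: weyl_group_def)

lemma weyl_one: "\<one>\<^bsub>W\<^esub> = id"
  by (simp add: weyl_group_def one_BijGroup_UNIV)

lemma weyl_id: "id \<in> carrier W"
  unfolding carrier_weyl by (auto intro!: image_eqI[of _ _ "[]"])

lemma weyl_comp: "v \<in> carrier W \<Longrightarrow> w \<in> carrier W \<Longrightarrow> v \<circ> w \<in> carrier W"
  unfolding carrier_weyl by (auto simp flip: reflection_word_append intro!: imageI)

lemma weyl_reflection: "\<alpha> \<in> \<Delta> \<Longrightarrow> reflection \<alpha> \<in> carrier W"
  unfolding carrier_weyl by (auto intro!: image_eqI[of _ _ "[\<alpha>]"])

lemma group_weyl: "group W"
proof -
  have "subgroup (generate (BijGroup UNIV) (reflection ` \<Phi>)) (BijGroup UNIV)"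
    by (rule group.generate_is_subgroup[OF group_BijGroup])
      (auto simp: carrier_BijGroup_UNIV bij_reflection)
  then show ?thesis
    unfolding weyl_group_def by (rule subgroup.subgroup_is_group) (rule group_BijGroup)
qed

lemma weyl_inv:
  assumes "w \<in> carrier W"
  shows "inv\<^bsub>W\<^esub> w \<in> carrier W" "inv\<^bsub>W\<^esub> w \<circ> w = id" "w \<circ> inv\<^bsub>W\<^esub> w = id"
proof -
  show *: "inv\<^bsub>W\<^esub> w \<in> carrier W"
    using group_weyl assms by (rule group.inv_closed)
  show "inv\<^bsub>W\<^esub> w \<circ> w = id" "w \<circ> inv\<^bsub>W\<^esub> w = id"
    using group.l_inv[OF group_weyl assms] group.r_inv[OF group_weyl assms]
    by (simp_all add: weyl_mult weyl_one assms *)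
qed

lemma weyl_inv_apply:
  assumes "w \<in> carrier W"
  shows "(inv\<^bsub>W\<^esub> w) (w x) = x" "w ((inv\<^bsub>W\<^esub> w) x) = x"
  using weyl_inv(2,3)[OF assms] by (simp_all add: fun_eq_iff)

lemma inv_reflection: "\<alpha> \<in> \<Delta> \<Longrightarrow> inv\<^bsub>W\<^esub> (reflection \<alpha>) = reflection \<alpha>"
  by (rule group.inv_equality[OF group_weyl]) (simp_all add: weyl_mult weyl_one weyl_reflection)

lemma weyl_root: "w \<in> carrier W \<Longrightarrow> \<beta> \<in> \<Phi> \<Longrightarrow> w \<beta> \<in> \<Phi>"
proof -
  have "reflection_word \<alpha>s \<beta> \<in> \<Phi>" if "\<alpha>s \<in> lists \<Delta>" "\<beta> \<in> \<Phi>" for \<alpha>s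
    using that by (induction \<alpha>s) (auto intro: reflection_root)
  then show "w \<in> carrier W \<Longrightarrow> \<beta> \<in> \<Phi> \<Longrightarrow> w \<beta> \<in> \<Phi>"
    by (auto simp: carrier_weyl)
qed

section \<open>Length as the number of inversions\<close>

lemma len_eq: "len w = (LEAST n. \<exists>\<alpha>s\<in>lists \<Delta>. length \<alpha>s = n \<and> reflection_word \<alpha>s = w)"
proof -
  have fold: "foldr (\<otimes>\<^bsub>W\<^esub>) (map reflection \<alpha>s) \<one>\<^bsub>W\<^esub> = reflection_word \<alpha>s"
    if "\<alpha>s \<in> lists \<Delta>" for \<alpha>s
    using that
  proof (induction \<alpha>s)
    case (Cons \<alpha> \<alpha>s)
    moreover from Cons.hyps have "reflection_word \<alpha>s \<in> carrier W"
      by (simp add: carrier_weyl)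
    ultimately show ?case
      by (simp add: weyl_mult weyl_reflection)
  qed (simp add: weyl_one)
  have "(\<exists>ss. length ss = n \<and> set ss \<subseteq> simple_reflections \<Delta> \<and> foldr (\<otimes>\<^bsub>W\<^esub>) ss \<one>\<^bsub>W\<^esub> = w)
    \<longleftrightarrow> (\<exists>\<alpha>s\<in>lists \<Delta>. length \<alpha>s = n \<and> reflection_word \<alpha>s = w)" for n
  proof
    assume "\<exists>ss. length ss = n \<and> set ss \<subseteq> simple_reflections \<Delta> \<and> foldr (\<otimes>\<^bsub>W\<^esub>) ss \<one>\<^bsub>W\<^esub> = w"
    then obtain ss where ss: "length ss = n" "ss \<in> lists (reflection ` \<Delta>)"
      "foldr (\<otimes>\<^bsub>W\<^esub>) ss \<one>\<^bsub>W\<^esub> = w"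
      by (auto simp: simple_reflections_def)
    then obtain \<alpha>s where "\<alpha>s \<in> lists \<Delta>" "ss = map reflection \<alpha>s"
      unfolding lists_image by blast
    with ss show "\<exists>\<alpha>s\<in>lists \<Delta>. length \<alpha>s = n \<and> reflection_word \<alpha>s = w"
      using fold by auto
  next
    assume "\<exists>\<alpha>s\<in>lists \<Delta>. length \<alpha>s = n \<and> reflection_word \<alpha>s = w"
    then obtain \<alpha>s where "\<alpha>s \<in> lists \<Delta>" "length \<alpha>s = n" "reflection_word \<alpha>s = w"
      by blast
    then show "\<exists>ss. length ss = n \<and> set ss \<subseteq> simple_reflections \<Delta> \<and> foldr (\<otimes>\<^bsub>W\<^esub>) ss \<one>\<^bsub>W\<^esub> = w"
      using fold[of \<alpha>s]
      by (intro exI[of _ "map reflection \<alpha>s"]) (auto simp: simple_reflections_def)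
  qed
  then show ?thesis
    by (simp add: word_length_def)
qed

lemma len_le: "\<alpha>s \<in> lists \<Delta> \<Longrightarrow> len (reflection_word \<alpha>s) \<le> length \<alpha>s"
  unfolding len_eq by (rule Least_le) blast

lemma reduced_word:
  assumes "w \<in> carrier W"
  obtains \<alpha>s where "\<alpha>s \<in> lists \<Delta>" "length \<alpha>s = len w" "reflection_word \<alpha>s = w"
proof -
  have "\<exists>n. \<exists>\<alpha>s\<in>lists \<Delta>. length \<alpha>s = n \<and> reflection_word \<alpha>s = w"
    using assms by (auto simp: carrier_weyl)
  from LeastI_ex[OF this] show ?thesis
    using that by (auto simp: len_eq)
qed

definition inversions :: "('a \<Rightarrow> 'a) \<Rightarrow> 'a set" where
  "inversions w = {\<beta> \<in> pos_roots. w \<beta> \<notin> pos_roots}"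

lemma finite_inversions: "finite (inversions w)"
  using finite_pos_roots by (simp add: inversions_def)

lemma weyl_uminus: "w \<in> carrier W \<Longrightarrow> w (- x) = - w x"
  using weyl_linear linear_neg by blast

lemma weyl_inj: "w \<in> carrier W \<Longrightarrow> w x = w y \<longleftrightarrow> x = y"
  by (simp add: weyl_bij bij_is_inj inj_eq)

text \<open>The reflection permutes the positive roots other than \<alpha>, and \<alpha> is not an
  inversion of \<open>w\<close>. So the old inversions are carried along injectively, and \<alpha>
  is added since \<open>w (- \<alpha>)\<close> is negative.\<close>

lemma inversions_right:
  assumes w: "w \<in> carrier W" and \<alpha>: "\<alpha> \<in> \<Delta>" "w \<alpha> \<in> pos_roots"
  shows "card (inversions (w \<circ> reflection \<alpha>)) = Suc (card (inversions w))"
proof -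
  have \<alpha>': "\<alpha> \<in> pos_roots" "- \<alpha> \<notin> pos_roots"
    using \<alpha> by (auto intro: simple_pos dest: uminus_simple_not_pos)
  have "inversions (w \<circ> reflection \<alpha>) = insert \<alpha> (reflection \<alpha> ` inversions w)" (is "?L = ?R")
  proof
    show "?L \<subseteq> ?R"
    proof
      fix \<beta>
      assume "\<beta> \<in> ?L"
      then show "\<beta> \<in> ?R"
        using reflection_pos[OF \<alpha>(1), of \<beta>]
        by (auto simp: inversions_def intro!: image_eqI[of _ _ "reflection \<alpha> \<beta>"])
    qed
    have "w (- \<alpha>) \<notin> pos_roots"
      using \<alpha> uminus_pos_iff[OF weyl_root[OF w]] w simple_roots by (auto simp: weyl_uminus)
    then show "?R \<subseteq> ?L"
      using \<alpha>' \<alpha> by (auto simp: inversions_def reflection_self intro: reflection_pos)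
  qed
  moreover have "\<alpha> \<notin> reflection \<alpha> ` inversions w"
  proof
    assume "\<alpha> \<in> reflection \<alpha> ` inversions w"
    then obtain \<beta> where "\<beta> \<in> inversions w" "\<alpha> = reflection \<alpha> \<beta>"
      by blast
    then have "\<beta> = - \<alpha>"
      using reflection_self[of \<alpha>] by (metis reflection_invol)
    then show False
      using \<open>\<beta> \<in> inversions w\<close> \<alpha>' by (simp add: inversions_def)
  qed
  moreover have "inj_on (reflection \<alpha>) A" for A
    by (metis inj_onI reflection_invol)
  ultimately show ?thesis
    by (simp add: finite_inversions card_image)
qed

text \<open>The outer reflection changes the sign of \<open>w \<beta>\<close> only if this is
  \<alpha> or \<open>- \<alpha>\<close>. For positive \<beta> the latter is impossible, as it means
  \<open>\<beta> = - \<gamma>\<close>, so \<gamma> is the only new inversion.\<close>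

lemma inversions_left:
  assumes w: "w \<in> carrier W" and \<alpha>: "\<alpha> \<in> \<Delta>" and \<gamma>: "\<gamma> \<in> pos_roots" "w \<gamma> = \<alpha>"
  shows "card (inversions (reflection \<alpha> \<circ> w)) = Suc (card (inversions w))"
proof -
  have self: "- \<alpha> \<notin> pos_roots" "\<alpha> \<in> pos_roots"
    using \<alpha> by (auto intro: simple_pos dest: uminus_simple_not_pos)
  have inj: "w \<beta> = \<alpha> \<longleftrightarrow> \<beta> = \<gamma>" for \<beta>
    unfolding \<gamma>(2)[symmetric] by (rule weyl_inj[OF w])
  have "w \<beta> = - \<alpha> \<longleftrightarrow> \<beta> = - \<gamma>" for \<beta>
    unfolding \<gamma>(2)[symmetric] weyl_uminus[OF w, symmetric] by (rule weyl_inj[OF w])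
  moreover have "- \<gamma> \<notin> pos_roots"
    using \<gamma>(1) uminus_pos_iff pos_roots_subset by blast
  ultimately have ne: "w \<beta> \<noteq> - \<alpha>" if "\<beta> \<in> pos_roots" for \<beta>
    using that by auto
  have flip: "reflection \<alpha> (w \<beta>) \<notin> pos_roots \<longleftrightarrow> w \<beta> \<notin> pos_roots \<or> \<beta> = \<gamma>"
    if "\<beta> \<in> pos_roots" for \<beta>
    using reflection_pos_iff[OF \<alpha> weyl_root[OF w pos_roots_subset[OF that]]] ne[OF that] inj[of \<beta>]
    by simp
  have "inversions (reflection \<alpha> \<circ> w) = insert \<gamma> (inversions w)"
  proof (rule Set.set_eqI)
    fix \<beta>
    show "\<beta> \<in> inversions (reflection \<alpha> \<circ> w) \<longleftrightarrow> \<beta> \<in> insert \<gamma> (inversions w)"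
    proof (cases "\<beta> \<in> pos_roots")
      case True
      then show ?thesis
        using flip[OF True] by (simp add: inversions_def disj_commute)
    next
      case False
      then show ?thesis
        using \<gamma>(1) by (auto simp: inversions_def)
    qed
  qed
  moreover have "\<gamma> \<notin> inversions w"
    using \<gamma> self by (simp add: inversions_def)
  ultimately show ?thesis
    by (simp add: finite_inversions)
qed

text \<open>Apply the letters to \<alpha> one by one from the right. The letter that first makes the
  image negative equals the image reached so far, since a simple reflection makes no other positive
  root negative. By \<open>orthogonal_transformation_comp_reflection\<close>, deleting that letter
  amounts to multiplying by the reflection in \<alpha> on the right.\<close>

lemma exchange:
  assumes "\<alpha>s \<in> lists \<Delta>" "\<alpha> \<in> \<Delta>" "reflection_word \<alpha>s \<alpha> \<notin> pos_roots"
  shows "\<exists>\<beta>s\<in>lists \<Delta>. length \<alpha>s = Suc (length \<beta>s)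
    \<and> reflection_word \<beta>s = reflection_word \<alpha>s \<circ> reflection \<alpha>"
  using assms(1,3)
proof (induction \<alpha>s)
  case Nil
  then show ?case
    using assms simple_pos by simp
next
  case (Cons \<beta> \<alpha>s)
  let ?w = "reflection_word \<alpha>s"
  show ?case
  proof (cases "?w \<alpha> \<in> pos_roots")
    case True
    then have "?w \<alpha> = \<beta>"
      using Cons.hyps Cons.prems reflection_pos[of \<beta> "?w \<alpha>"] by auto
    then have "?w \<circ> reflection \<alpha> = reflection \<beta> \<circ> ?w"
      using orthogonal_transformation_comp_reflection[OF orthogonal_transformation_word] by metis
    then have "?w = reflection_word (\<beta> # \<alpha>s) \<circ> reflection \<alpha>"
      by (simp add: fun_eq_iff)
    then show ?thesis
      using Cons.hyps by (metis length_Cons)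
  next
    case False
    then obtain \<beta>s where "\<beta>s \<in> lists \<Delta>" "length \<alpha>s = Suc (length \<beta>s)"
      "reflection_word \<beta>s = ?w \<circ> reflection \<alpha>"
      using Cons.IH by blast
    then show ?thesis
      using Cons.hyps by (intro bexI[of _ "\<beta> # \<beta>s"]) (auto simp: comp_assoc)
  qed
qed

text \<open>Strip the last letter \<alpha> from a reduced word. The remaining element keeps \<alpha>
  positive, for otherwise \<open>exchange\<close> would give \<open>w\<close> too short a word;
  hence the last letter adds exactly one inversion.\<close>

lemma len_eq_card_inversions:
  "w \<in> carrier W \<Longrightarrow> len w = card (inversions w)"
proof (induction "len w" arbitrary: w rule: less_induct)
  case less
  obtain \<alpha>s where \<alpha>s: "\<alpha>s \<in> lists \<Delta>" "length \<alpha>s = len w" "reflection_word \<alpha>s = w"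
    using reduced_word less.prems by blast
  show ?case
  proof (cases \<alpha>s rule: rev_cases)
    case Nil
    then show ?thesis
      using \<alpha>s by (auto simp: inversions_def)
  next
    case (snoc \<beta>s \<alpha>)
    let ?v = "reflection_word \<beta>s"
    have \<beta>s: "\<beta>s \<in> lists \<Delta>" "\<alpha> \<in> \<Delta>" "?v \<in> carrier W" and w: "w = ?v \<circ> reflection \<alpha>"
      using snoc \<alpha>s by (auto simp: carrier_weyl)
    \<comment> \<open>An initial segment of a reduced word is reduced: a shorter word for
      \<open>?v\<close>, followed by \<alpha>, would be a shorter word for \<open>w\<close>.\<close>
    have "len ?v = length \<beta>s"
    proof -
      obtain \<gamma>s where \<gamma>s: "\<gamma>s \<in> lists \<Delta>" "length \<gamma>s = len ?v" "reflection_word \<gamma>s = ?v"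
        using reduced_word \<beta>s by blast
      then have "len w \<le> length (\<gamma>s @ [\<alpha>])"
        using len_le[of "\<gamma>s @ [\<alpha>]"] \<beta>s w by auto
      then show ?thesis
        using \<gamma>s \<alpha>s snoc len_le[OF \<beta>s(1)] by simp
    qed
    then have IH: "len w = Suc (len ?v)" "card (inversions ?v) = len ?v"
      using less.hyps[of ?v] \<alpha>s snoc \<beta>s by auto
    have "?v \<alpha> \<in> pos_roots"
    proof (rule ccontr)
      assume "\<not> ?thesis"
      then obtain \<gamma>s where "\<gamma>s \<in> lists \<Delta>" "length \<beta>s = Suc (length \<gamma>s)" "reflection_word \<gamma>s = w"
        using exchange \<beta>s w by blast
      then show False
        using len_le[of \<gamma>s] IH \<open>len ?v = length \<beta>s\<close> by simp
    qed
    then show ?thesis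
      using inversions_right[OF \<beta>s(3,2)] IH w by simp
  qed
qed

lemma len_right:
  assumes "w \<in> carrier W" "\<alpha> \<in> \<Delta>" "w \<alpha> \<in> pos_roots"
  shows "len (w \<circ> reflection \<alpha>) = Suc (len w)"
  using inversions_right[OF assms] assms weyl_comp weyl_reflection
  by (simp add: len_eq_card_inversions)

lemma len_left:
  assumes "w \<in> carrier W" "\<alpha> \<in> \<Delta>" "\<gamma> \<in> pos_roots" "w \<gamma> = \<alpha>"
  shows "len (reflection \<alpha> \<circ> w) = Suc (len w)"
  using inversions_left[OF assms] assms weyl_comp weyl_reflection
  by (simp add: len_eq_card_inversions)

text \<open>According to the sign of the root that \<open>w\<close> sends to \<alpha>,
  \<open>len_left\<close> applies either to \<open>w\<close> or to
  \<open>reflection \<alpha> \<circ> w\<close>.\<close>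

lemma len_left_ge:
  assumes w: "w \<in> carrier W" and \<alpha>: "\<alpha> \<in> \<Delta>"
  shows "len w \<le> Suc (len (reflection \<alpha> \<circ> w))"
proof -
  let ?\<gamma> = "(inv\<^bsub>W\<^esub> w) \<alpha>"
  have \<gamma>: "w ?\<gamma> = \<alpha>" "?\<gamma> \<in> \<Phi>"
    using w \<alpha> weyl_inv_apply weyl_inv(1) weyl_root simple_roots by auto
  show ?thesis
  proof (cases "?\<gamma> \<in> pos_roots")
    case True
    then show ?thesis
      using len_left[OF w \<alpha> True] \<gamma> by simp
  next
    case False
    have "len (reflection \<alpha> \<circ> (reflection \<alpha> \<circ> w)) = Suc (len (reflection \<alpha> \<circ> w))"
    proof (rule len_left)
      show "- ?\<gamma> \<in> pos_roots"
        using False \<gamma> uminus_pos_iff by blast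
      have "(reflection \<alpha> \<circ> w) (- ?\<gamma>) = reflection \<alpha> (- \<alpha>)"
        using \<gamma>(1) w by (simp add: weyl_uminus)
      also have "\<dots> = \<alpha>"
        using reflection_self[of \<alpha>] by (metis reflection_invol)
      finally show "(reflection \<alpha> \<circ> w) (- ?\<gamma>) = \<alpha>" .
    qed (use w \<alpha> weyl_comp weyl_reflection in auto)
    then show ?thesis
      by (simp flip: comp_assoc)
  qed
qed

section \<open>Elements that fix each simple root or make it negative\<close>

lemma no_inversions_imp_id:
  assumes "w \<in> carrier W" "\<And>\<beta>. \<beta> \<in> pos_roots \<Longrightarrow> w \<beta> \<in> pos_roots"
  shows "w = id"
proof -
  have "inversions w = {}"
    using assms by (auto simp: inversions_def)
  then have "len w = 0"
    using assms len_eq_card_inversions by simp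
  then show ?thesis
    using reduced_word[OF assms(1)] by (metis length_0_conv reflection_word_Nil)
qed

text \<open>With \<open>J\<close> the set of fixed simple roots, it suffices that \<beta> is
  supported on \<open>J\<close>. Suppose \<beta> involves some \<alpha> outside \<open>J\<close>. At
  each \<gamma> outside \<open>J\<close> the coordinate of \<open>w \<beta>\<close> is nonnegative,
  yet it is a sum of nonpositive terms; hence every term vanishes, and so does the coordinate of
  \<open>w \<alpha>\<close> at \<gamma>.\<close>

lemma simple_dichotomy_imp_pos_dichotomy:
  assumes w: "w \<in> carrier W"
    and simple: "\<forall>\<alpha>\<in>\<Delta>. w \<alpha> \<in> pos_roots \<longrightarrow> w \<alpha> = \<alpha>"
    and \<beta>: "\<beta> \<in> pos_roots" "w \<beta> \<in> pos_roots"
  shows "w \<beta> = \<beta>"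
proof -
  define J where "J = {\<alpha>\<in>\<Delta>. w \<alpha> = \<alpha>}"
  have \<beta>\<Phi>: "\<beta> \<in> \<Phi>"
    using \<beta> pos_roots_subset by blast
  have fixed: "w \<gamma> = \<gamma>" if "\<gamma> \<in> \<Phi>" "\<And>\<alpha>. \<alpha> \<in> \<Delta> - J \<Longrightarrow> coord \<gamma> \<alpha> = 0" for \<gamma>
  proof -
    have "w \<gamma> = (\<Sum>\<alpha>\<in>\<Delta>. coord \<gamma> \<alpha> *\<^sub>R w \<alpha>)"
      by (subst sum_coord[OF that(1), symmetric])
        (simp add: linear_sum[OF weyl_linear[OF w]] linear_scale[OF weyl_linear[OF w]])
    also have "\<dots> = (\<Sum>\<alpha>\<in>\<Delta>. coord \<gamma> \<alpha> *\<^sub>R \<alpha>)"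
      using that(2) by (intro sum.cong) (auto simp: J_def)
    finally show ?thesis
      using sum_coord[OF that(1)] by simp
  qed
  have "coord \<beta> \<alpha> = 0" if \<alpha>: "\<alpha> \<in> \<Delta> - J" for \<alpha>
  proof (rule ccontr)
    assume "coord \<beta> \<alpha> \<noteq> 0"
    then have pos: "coord \<beta> \<alpha> > 0"
      using \<beta>(1) \<alpha> by (force simp: pos_roots_def)
    have neg: "coord (w \<delta>) \<gamma> \<le> 0" if "\<delta> \<in> \<Delta> - J" "\<gamma> \<in> \<Delta>" for \<delta> \<gamma>
    proof -
      have "w \<delta> \<notin> pos_roots" "w \<delta> \<in> \<Phi>"
        using that simple weyl_root[OF w] simple_roots by (auto simp: J_def)
      then show ?thesis
        using that pos_coord_witness by force
    qed
    have "coord (w \<alpha>) \<gamma> = 0" if \<gamma>: "\<gamma> \<in> \<Delta> - J" for \<gamma>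
    proof -
      \<comment> \<open>Roots in \<open>J\<close> are fixed and have coordinate 0 at \<gamma>; the
        other simple roots are made negative.\<close>
      have nonpos: "coord \<beta> \<delta> * coord (w \<delta>) \<gamma> \<le> 0" if "\<delta> \<in> \<Delta>" for \<delta>
      proof (cases "\<delta> \<in> J")
        case True
        then have "w \<delta> = \<delta>" "\<gamma> \<noteq> \<delta>"
          using \<gamma> by (auto simp: J_def)
        then show ?thesis
          using coord_simple[OF that] by simp
      next
        case False
        then show ?thesis
          using neg[of \<delta> \<gamma>] that \<gamma> \<beta>(1) by (auto simp: pos_roots_def mult_le_0_iff)
      qed
      have "w \<beta> = (\<Sum>\<delta>\<in>\<Delta>. coord \<beta> \<delta> *\<^sub>R w \<delta>)"
        by (subst sum_coord[OF \<beta>\<Phi>, symmetric])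
          (simp add: linear_sum[OF weyl_linear[OF w]] linear_scale[OF weyl_linear[OF w]])
      then have "coord (w \<beta>) \<gamma> = (\<Sum>\<delta>\<in>\<Delta>. coord \<beta> \<delta> * coord (w \<delta>) \<gamma>)"
        using simple_roots weyl_root[OF w] roots_span
        by (simp add: real_vector.representation_sum[OF independent]
            real_vector.representation_scale[OF independent] span_scale subset_iff)
      moreover have "0 \<le> coord (w \<beta>) \<gamma>"
        using \<beta>(2) \<gamma> by (simp add: pos_roots_def)
      moreover have "(\<Sum>\<delta>\<in>\<Delta>. coord \<beta> \<delta> * coord (w \<delta>) \<gamma>)
          = coord \<beta> \<alpha> * coord (w \<alpha>) \<gamma> + (\<Sum>\<delta>\<in>\<Delta> - {\<alpha>}. coord \<beta> \<delta> * coord (w \<delta>) \<gamma>)"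
        using \<alpha> finite_simple by (intro sum.remove) auto
      moreover have "(\<Sum>\<delta>\<in>\<Delta> - {\<alpha>}. coord \<beta> \<delta> * coord (w \<delta>) \<gamma>) \<le> 0"
        using nonpos by (intro sum_nonpos) auto
      moreover have "coord \<beta> \<alpha> * coord (w \<alpha>) \<gamma> \<le> 0"
        using nonpos \<alpha> by blast
      ultimately have "coord \<beta> \<alpha> * coord (w \<alpha>) \<gamma> = 0"
        by linarith
      then show ?thesis
        using pos by simp
    qed
    \<comment> \<open>Now \<open>w \<alpha>\<close> is itself supported on \<open>J\<close>, hence
      fixed; cancelling \<open>w\<close> puts \<alpha> into \<open>J\<close>, a
      contradiction.\<close>
    then have "w (w \<alpha>) = w \<alpha>"
      using \<alpha> weyl_root[OF w] simple_roots by (intro fixed) auto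
    then have "w \<alpha> = \<alpha>"
      using weyl_inj[OF w] by blast
    then show False
      using \<alpha> by (simp add: J_def)
  qed
  then show ?thesis
    by (intro fixed \<beta>\<Phi>)
qed

text \<open>The square has no inversions. Only a positive \<beta> with \<open>w \<beta>\<close>
  negative is in question: if \<open>w\<close> kept the positive root \<open>- w \<beta>\<close>
  positive, it would fix it, and cancelling \<open>w\<close> would give
  \<open>w \<beta> = \<beta>\<close>.\<close>

lemma simple_dichotomy_imp_involution:
  assumes w: "w \<in> carrier W"
    and simple: "\<forall>\<alpha>\<in>\<Delta>. w \<alpha> \<in> pos_roots \<longrightarrow> w \<alpha> = \<alpha>"
  shows "w \<circ> w = id"
proof (rule no_inversions_imp_id)
  fix \<beta>
  assume \<beta>: "\<beta> \<in> pos_roots"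
  note dich = simple_dichotomy_imp_pos_dichotomy[OF w simple]
  have \<Phi>: "\<beta> \<in> \<Phi>" "w \<beta> \<in> \<Phi>" "w (w \<beta>) \<in> \<Phi>"
    using \<beta> pos_roots_subset weyl_root[OF w] by auto
  show "(w \<circ> w) \<beta> \<in> pos_roots"
  proof (cases "w \<beta> \<in> pos_roots")
    case True
    then show ?thesis
      using dich[OF \<beta> True] \<beta> by simp
  next
    case False
    then have neg: "- w \<beta> \<in> pos_roots"
      using \<Phi> uminus_pos_iff by blast
    show ?thesis
    proof (rule ccontr)
      assume "\<not> ?thesis"
      then have "w (- w \<beta>) \<in> pos_roots"
        using \<Phi> uminus_pos_iff[of "w (w \<beta>)"] by (simp add: weyl_uminus[OF w])
      then have "w (- w \<beta>) = - w \<beta>"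
        using dich neg by blast
      then have "w (w \<beta>) = w \<beta>"
        by (simp add: weyl_uminus[OF w])
      then have "w \<beta> = \<beta>"
        using weyl_inj[OF w] by blast
      then show False
        using False \<beta> by simp
    qed
  qed
qed (use w weyl_comp in auto)

text \<open>The inversions are exactly the positive roots that are not fixed, and fixed roots come
  in pairs of opposites. Fixed roots are counted in all of \<Phi> because conjugating elements
  permute \<Phi>, but in general not the positive roots.\<close>

lemma len_of_simple_dichotomy:
  assumes w: "w \<in> carrier W"
    and simple: "\<forall>\<alpha>\<in>\<Delta>. w \<alpha> \<in> pos_roots \<longrightarrow> w \<alpha> = \<alpha>"
  shows "2 * len w + card {\<beta>\<in>\<Phi>. w \<beta> = \<beta>} = 2 * card pos_roots"
proof -
  define F where "F = {\<beta>\<in>pos_roots. w \<beta> = \<beta>}"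
  have F: "finite F" "F \<subseteq> pos_roots"
    using finite_pos_roots by (auto simp: F_def)
  have "inversions w = pos_roots - F"
    using simple_dichotomy_imp_pos_dichotomy[OF w simple] by (auto simp: F_def inversions_def)
  then have "len w = card pos_roots - card F"
    using F w by (simp add: len_eq_card_inversions card_Diff_subset)
  moreover have "card F \<le> card pos_roots"
    using F finite_pos_roots card_mono by blast
  moreover have "card {\<beta>\<in>\<Phi>. w \<beta> = \<beta>} = 2 * card F"
  proof -
    have "{\<beta>\<in>\<Phi>. w \<beta> = \<beta>} = F \<union> uminus ` F" (is "?L = ?R")
    proof
      show "?R \<subseteq> ?L"
        using pos_roots_subset uminus_root by (auto simp: F_def weyl_uminus[OF w])
      show "?L \<subseteq> ?R"
      proof
        fix \<beta>
        assume "\<beta> \<in> ?L"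
        then show "\<beta> \<in> ?R"
          using uminus_pos_iff[of \<beta>]
          by (cases "\<beta> \<in> pos_roots")
            (auto simp: F_def weyl_uminus[OF w] intro!: image_eqI[of _ _ "- \<beta>"])
      qed
    qed
    moreover have "F \<inter> uminus ` F = {}"
      using uminus_pos_iff pos_roots_subset by (auto simp: F_def)
    moreover have "card (uminus ` F) = card F"
      by (simp add: card_image)
    ultimately show ?thesis
      using F by (simp add: card_Un_disjoint)
  qed
  ultimately show ?thesis
    by simp
qed

section \<open>Conjugacy classes of the Weyl group\<close>

lemma conjugacy_classes_weyl:
  "conjugacy_classes W = {{g \<circ> x \<circ> inv\<^bsub>W\<^esub> g | g. g \<in> carrier W} | x. x \<in> carrier W}"
proof -
  have "g \<otimes>\<^bsub>W\<^esub> x \<otimes>\<^bsub>W\<^esub> inv\<^bsub>W\<^esub> g = g \<circ> x \<circ> inv\<^bsub>W\<^esub> g" if "g \<in> carrier W" "x \<in> carrier W" for g x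
    by (simp only: that weyl_mult weyl_inv(1) weyl_comp)
  then have *: "orbit W (\<lambda>g. \<lambda>h\<in>carrier W. g \<otimes>\<^bsub>W\<^esub> h \<otimes>\<^bsub>W\<^esub> inv\<^bsub>W\<^esub> g) x
      = {g \<circ> x \<circ> inv\<^bsub>W\<^esub> g | g. g \<in> carrier W}" if "x \<in> carrier W" for x
    using that by (simp add: orbit_def cong: rev_conj_cong)
  show ?thesis
    unfolding conjugacy_classes_def orbits_def by (simp add: * cong: rev_conj_cong)
qed

lemma inv_comp:
  assumes "g \<in> carrier W" "h \<in> carrier W"
  shows "inv\<^bsub>W\<^esub> (g \<circ> h) = inv\<^bsub>W\<^esub> h \<circ> inv\<^bsub>W\<^esub> g"
  using group.inv_mult_group[OF group_weyl assms] by (simp only: weyl_mult weyl_inv(1) assms)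

lemma conjugacy_class_carrier: "C \<in> conjugacy_classes W \<Longrightarrow> \<tau> \<in> C \<Longrightarrow> \<tau> \<in> carrier W"
  unfolding conjugacy_classes_weyl by (blast intro: weyl_comp weyl_inv(1))

lemma conjugacy_class_conj:
  assumes "C \<in> conjugacy_classes W" "\<tau> \<in> C" "g \<in> carrier W"
  shows "g \<circ> \<tau> \<circ> inv\<^bsub>W\<^esub> g \<in> C"
proof -
  obtain x where C: "C = {g \<circ> x \<circ> inv\<^bsub>W\<^esub> g | g. g \<in> carrier W}"
    using assms(1) unfolding conjugacy_classes_weyl by blast
  with assms(2) obtain h where h: "h \<in> carrier W" "\<tau> = h \<circ> x \<circ> inv\<^bsub>W\<^esub> h"
    by blast
  then have "g \<circ> \<tau> \<circ> inv\<^bsub>W\<^esub> g = (g \<circ> h) \<circ> x \<circ> inv\<^bsub>W\<^esub> (g \<circ> h)"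
    by (simp only: inv_comp assms(3) comp_assoc)
  then show ?thesis
    unfolding C using h(1) assms(3) weyl_comp by blast
qed

lemma conjugacy_class_conjugate:
  assumes "C \<in> conjugacy_classes W" "\<sigma> \<in> C" "\<tau> \<in> C"
  obtains g where "g \<in> carrier W" "\<tau> = g \<circ> \<sigma> \<circ> inv\<^bsub>W\<^esub> g"
proof -
  obtain x where "C = {g \<circ> x \<circ> inv\<^bsub>W\<^esub> g | g. g \<in> carrier W}"
    using assms(1) unfolding conjugacy_classes_weyl by blast
  with assms(2,3) obtain h k where C: "h \<in> carrier W" "\<sigma> = h \<circ> x \<circ> inv\<^bsub>W\<^esub> h"
    "k \<in> carrier W" "\<tau> = k \<circ> x \<circ> inv\<^bsub>W\<^esub> k"
    by blast
  show thesis
  proof (rule that)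
    \<comment> \<open>Going from \<sigma> back to \<open>x\<close> by the inverse of
      \<open>h\<close> and on to \<tau> by \<open>k\<close> gives the conjugating element.\<close>
    show "k \<circ> inv\<^bsub>W\<^esub> h \<in> carrier W"
      by (intro weyl_comp C weyl_inv)
    have "inv\<^bsub>W\<^esub> (k \<circ> inv\<^bsub>W\<^esub> h) = h \<circ> inv\<^bsub>W\<^esub> k"
      unfolding inv_comp[OF C(3) weyl_inv(1)[OF C(1)]] group.inv_inv[OF group_weyl C(1)] ..
    then show "\<tau> = (k \<circ> inv\<^bsub>W\<^esub> h) \<circ> \<sigma> \<circ> inv\<^bsub>W\<^esub> (k \<circ> inv\<^bsub>W\<^esub> h)"
      unfolding C(2,4) by (simp add: fun_eq_iff weyl_inv_apply(1)[OF C(1)])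
  qed
qed

lemma card_fixed_conj:
  assumes "g \<in> carrier W" "\<tau> = g \<circ> \<sigma> \<circ> inv\<^bsub>W\<^esub> g"
  shows "card {\<beta>\<in>\<Phi>. \<tau> \<beta> = \<beta>} = card {\<beta>\<in>\<Phi>. \<sigma> \<beta> = \<beta>}"
proof (rule sym, rule bij_betw_same_card)
  show "bij_betw g {\<beta>\<in>\<Phi>. \<sigma> \<beta> = \<beta>} {\<beta>\<in>\<Phi>. \<tau> \<beta> = \<beta>}"
  proof (rule bij_betwI[where g = "inv\<^bsub>W\<^esub> g"])
    show "inv\<^bsub>W\<^esub> g \<in> {\<beta>\<in>\<Phi>. \<tau> \<beta> = \<beta>} \<rightarrow> {\<beta>\<in>\<Phi>. \<sigma> \<beta> = \<beta>}"
    proof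
      fix \<beta>
      assume "\<beta> \<in> {\<beta>\<in>\<Phi>. \<tau> \<beta> = \<beta>}"
      then have "\<beta> \<in> \<Phi>" "g (\<sigma> ((inv\<^bsub>W\<^esub> g) \<beta>)) = \<beta>"
        unfolding assms(2) by auto
      then show "(inv\<^bsub>W\<^esub> g) \<beta> \<in> {\<beta>\<in>\<Phi>. \<sigma> \<beta> = \<beta>}"
        using weyl_inv_apply(1)[OF assms(1), of "\<sigma> ((inv\<^bsub>W\<^esub> g) \<beta>)"]
          weyl_root[OF weyl_inv(1)[OF assms(1)]] by simp
    qed
  qed (use assms weyl_root in \<open>auto simp: weyl_inv_apply\<close>)
qed

section \<open>Bruhat order and unique longest elements\<close>

lemma bruhat_le_len:
  assumes "bruhat_le W (simple_reflections \<Delta>) u v"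
  shows "u = v \<or> len u < len v"
  using assms unfolding bruhat_le_def by induction auto

lemma bruhat_le_left:
  assumes "w \<in> carrier W" "\<alpha> \<in> \<Delta>" "len w < len (reflection \<alpha> \<circ> w)"
  shows "bruhat_le W (simple_reflections \<Delta>) w (reflection \<alpha> \<circ> w)"
proof -
  \<comment> \<open>Membership in \<open>all_reflections\<close> asks for a conjugate of a simple
    reflection; conjugation by \<open>id\<close> provides it.\<close>
  have "reflection \<alpha> = id \<otimes>\<^bsub>W\<^esub> reflection \<alpha> \<otimes>\<^bsub>W\<^esub> inv\<^bsub>W\<^esub> id"
    using assms weyl_id weyl_reflection weyl_inv[OF weyl_id] by (simp add: weyl_mult)
  then have "reflection \<alpha> \<in> all_reflections W (simple_reflections \<Delta>)"
    unfolding all_reflections_def simple_reflections_def using assms(2) weyl_id by blast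
  moreover have "reflection \<alpha> \<circ> w = reflection \<alpha> \<otimes>\<^bsub>W\<^esub> w"
    using assms weyl_reflection by (simp add: weyl_mult)
  ultimately show ?thesis
    unfolding bruhat_le_def using assms by (intro r_into_rtranclp) blast
qed

text \<open>Bruhat steps multiply on the left, so the right factor is moved across \<open>w\<close>,
  where it becomes its conjugate by \<open>w\<close>.\<close>

lemma bruhat_le_right:
  assumes "w \<in> carrier W" "\<alpha> \<in> \<Delta>" "len w < len (w \<circ> reflection \<alpha>)"
  shows "bruhat_le W (simple_reflections \<Delta>) w (w \<circ> reflection \<alpha>)"
proof -
  let ?t = "w \<otimes>\<^bsub>W\<^esub> reflection \<alpha> \<otimes>\<^bsub>W\<^esub> inv\<^bsub>W\<^esub> w"
  have t: "?t \<in> all_reflections W (simple_reflections \<Delta>)"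
    unfolding all_reflections_def simple_reflections_def using assms(1,2) by blast
  have "w \<circ> reflection \<alpha> = ?t \<otimes>\<^bsub>W\<^esub> w"
    using assms weyl_reflection weyl_comp weyl_inv(1)
    by (simp add: weyl_mult) (simp add: fun_eq_iff weyl_inv_apply)
  then show ?thesis
    unfolding bruhat_le_def using assms t by (intro r_into_rtranclp) blast
qed

text \<open>Multiplying \<sigma> by the reflection on the right gains one in length, and multiplying
  on the left then loses at most one. The conjugate is therefore no shorter than \<sigma>, hence
  equal to it. Evaluating at \<alpha> shows that the reflection negates
  \<open>\<sigma> \<alpha>\<close>, which is impossible for a positive root other than
  \<alpha>.\<close>

lemma unique_longest_simple_dichotomy:
  assumes C: "C \<in> conjugacy_classes W" and \<sigma>: "\<sigma> \<in> C"
    and longest: "\<And>\<tau>. \<tau> \<in> C \<Longrightarrow> \<tau> \<noteq> \<sigma> \<Longrightarrow> len \<tau> < len \<sigma>"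
    and \<alpha>: "\<alpha> \<in> \<Delta>" "\<sigma> \<alpha> \<in> pos_roots"
  shows "\<sigma> \<alpha> = \<alpha>"
proof (rule ccontr)
  assume ne: "\<sigma> \<alpha> \<noteq> \<alpha>"
  have \<sigma>W: "\<sigma> \<in> carrier W"
    using C \<sigma> by (rule conjugacy_class_carrier)
  let ?\<tau> = "reflection \<alpha> \<circ> (\<sigma> \<circ> reflection \<alpha>)"
  have "?\<tau> \<in> C"
    using conjugacy_class_conj[OF C \<sigma> weyl_reflection[OF \<alpha>(1)]] inv_reflection[OF \<alpha>(1)]
    by (simp add: comp_assoc)
  moreover have "len \<sigma> \<le> len ?\<tau>"
    using len_right[OF \<sigma>W \<alpha>] len_left_ge[of "\<sigma> \<circ> reflection \<alpha>" \<alpha>] \<alpha>(1) \<sigma>W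
      weyl_comp weyl_reflection by simp
  ultimately have "?\<tau> = \<sigma>"
    using longest by (metis leD)
  then have "reflection \<alpha> (\<sigma> (reflection \<alpha> \<alpha>)) = \<sigma> \<alpha>"
    by (metis comp_apply)
  then have "reflection \<alpha> (\<sigma> \<alpha>) = - \<sigma> \<alpha>"
    using linear_neg[OF linear_reflection, of \<alpha>] \<sigma>W
    by (metis add.inverse_inverse reflection_self weyl_uminus)
  moreover have "reflection \<alpha> (\<sigma> \<alpha>) \<in> pos_roots"
    using reflection_pos \<alpha> ne by blast
  ultimately show False
    using \<alpha>(2) uminus_pos_iff pos_roots_subset by metis
qed

text \<open>Induction on how much shorter than \<sigma> the element is: each conjugation in the
  first case climbs two Bruhat steps and stays in \<open>C\<close>.\<close>

lemma unique_longest_imp_bruhat_maximum: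
  assumes C: "C \<in> conjugacy_classes W" and \<sigma>: "\<sigma> \<in> C"
    and longest: "\<And>\<tau>. \<tau> \<in> C \<Longrightarrow> \<tau> \<noteq> \<sigma> \<Longrightarrow> len \<tau> < len \<sigma>"
    and \<tau>: "\<tau> \<in> C"
  shows "bruhat_le W (simple_reflections \<Delta>) \<tau> \<sigma>"
  using \<tau>
proof (induction "len \<sigma> - len \<tau>" arbitrary: \<tau> rule: less_induct)
  case less
  have \<sigma>W: "\<sigma> \<in> carrier W" and \<tau>W: "\<tau> \<in> carrier W"
    using C \<sigma> less.prems conjugacy_class_carrier by auto
  have simple: "\<forall>\<alpha>\<in>\<Delta>. \<sigma> \<alpha> \<in> pos_roots \<longrightarrow> \<sigma> \<alpha> = \<alpha>"
    using unique_longest_simple_dichotomy[OF C \<sigma> longest] by blast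
  obtain g where g: "g \<in> carrier W" "\<tau> = g \<circ> \<sigma> \<circ> inv\<^bsub>W\<^esub> g"
    using conjugacy_class_conjugate[OF C \<sigma> less.prems] .
  have "\<sigma> \<circ> \<sigma> = id"
    using simple_dichotomy_imp_involution[OF \<sigma>W simple] .
  \<comment> \<open>Being an involution passes from \<sigma> to its conjugates.\<close>
  then have invol: "\<tau> (\<tau> x) = x" for x
    using g by (simp add: fun_eq_iff weyl_inv_apply)
  show ?case
  proof (cases "\<exists>\<alpha>\<in>\<Delta>. \<tau> \<alpha> \<in> pos_roots \<and> \<tau> \<alpha> \<noteq> \<alpha>")
    case True
    then obtain \<alpha> where \<alpha>: "\<alpha> \<in> \<Delta>" "\<tau> \<alpha> \<in> pos_roots" "\<tau> \<alpha> \<noteq> \<alpha>"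
      by blast
    let ?u = "reflection \<alpha> \<circ> \<tau>"
    let ?v = "?u \<circ> reflection \<alpha>"
    have uW: "?u \<in> carrier W"
      using \<alpha>(1) \<tau>W weyl_comp weyl_reflection by blast
    \<comment> \<open>\<open>len_left\<close> needs a positive root that \<tau> sends to \<alpha>;
      since \<tau> is an involution, this is \<open>\<tau> \<alpha>\<close>.\<close>
    have lenu: "len ?u = Suc (len \<tau>)"
      using len_left[OF \<tau>W \<alpha>(1,2)] invol by blast
    have "?u \<alpha> \<in> pos_roots"
      using \<alpha> reflection_pos by simp
    then have lenv: "len ?v = Suc (len ?u)"
      using len_right uW \<alpha>(1) by blast
    have vC: "?v \<in> C"
      using conjugacy_class_conj[OF C less.prems weyl_reflection[OF \<alpha>(1)]]
        inv_reflection[OF \<alpha>(1)] by simp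
    then have "len ?v \<le> len \<sigma>"
      using longest by (metis less_imp_le order_refl)
    then have "bruhat_le W (simple_reflections \<Delta>) ?v \<sigma>"
      using less.hyps vC lenu lenv by simp
    moreover have "bruhat_le W (simple_reflections \<Delta>) \<tau> ?u"
      using bruhat_le_left \<tau>W \<alpha>(1) lenu by simp
    moreover have "bruhat_le W (simple_reflections \<Delta>) ?u ?v"
      using bruhat_le_right[OF uW \<alpha>(1)] lenv by simp
    ultimately show ?thesis
      unfolding bruhat_le_def by (meson rtranclp_trans)
  next
    case False
    \<comment> \<open>In this case \<tau> satisfies the same dichotomy as \<sigma>, so both lengths
      are determined by the number of fixed roots, on which conjugates agree.\<close>
    then have "2 * len \<tau> + card {\<beta>\<in>\<Phi>. \<tau> \<beta> = \<beta>} = 2 * card pos_roots"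
      using len_of_simple_dichotomy \<tau>W by blast
    moreover have "2 * len \<sigma> + card {\<beta>\<in>\<Phi>. \<sigma> \<beta> = \<beta>} = 2 * card pos_roots"
      using len_of_simple_dichotomy \<sigma>W simple by blast
    ultimately have "len \<tau> = len \<sigma>"
      using card_fixed_conj[OF g] by simp
    then have "\<tau> = \<sigma>"
      using longest[OF less.prems] by fastforce
    then show ?thesis
      by (simp add: bruhat_le_def)
  qed
qed

end

theorem theorem2p15:
  fixes V \<Phi> \<Delta> :: "'a::euclidean_space set"
  assumes "root_system V \<Phi>"
    and "root_basis V \<Phi> \<Delta>"
  shows "classes_with_unique_longest (weyl_group \<Phi>) (simple_reflections \<Delta>) =
         classes_with_bruhat_maximum (weyl_group \<Phi>) (simple_reflections \<Delta>)"
proof -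
  interpret based_root_system V \<Phi> \<Delta>
    using assms by unfold_locales
  have "(\<exists>!\<sigma>. is_arg_max len (\<lambda>\<tau>. \<tau> \<in> C) \<sigma>) \<longleftrightarrow>
    (\<exists>\<sigma>\<in>C. \<forall>\<tau>\<in>C. bruhat_le W (simple_reflections \<Delta>) \<tau> \<sigma>)"
    if C: "C \<in> conjugacy_classes W" for C
  proof
    assume "\<exists>!\<sigma>. is_arg_max len (\<lambda>\<tau>. \<tau> \<in> C) \<sigma>"
    then obtain \<sigma> where \<sigma>: "\<sigma> \<in> C" "\<And>\<tau>. \<tau> \<in> C \<Longrightarrow> len \<tau> \<le> len \<sigma>"
      and unique: "\<And>\<tau>. is_arg_max len (\<lambda>\<tau>. \<tau> \<in> C) \<tau> \<Longrightarrow> \<tau> = \<sigma>"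
      unfolding is_arg_max_linorder by metis
    have "len \<tau> < len \<sigma>" if "\<tau> \<in> C" "\<tau> \<noteq> \<sigma>" for \<tau>
      using that \<sigma> unique[of \<tau>] unfolding is_arg_max_linorder by (meson leI order_trans)
    then show "\<exists>\<sigma>\<in>C. \<forall>\<tau>\<in>C. bruhat_le W (simple_reflections \<Delta>) \<tau> \<sigma>"
      using unique_longest_imp_bruhat_maximum[OF C \<sigma>(1)] \<sigma>(1) by blast
  next
    assume "\<exists>\<sigma>\<in>C. \<forall>\<tau>\<in>C. bruhat_le W (simple_reflections \<Delta>) \<tau> \<sigma>"
    \<comment> \<open>Every Bruhat step strictly raises the length, so a Bruhat maximum is strictly
      longer than all other elements of its class.\<close>
    then obtain \<sigma> where "\<sigma> \<in> C" "\<And>\<tau>. \<tau> \<in> C \<Longrightarrow> \<tau> = \<sigma> \<or> len \<tau> < len \<sigma>"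
      using bruhat_le_len by blast
    then show "\<exists>!\<sigma>. is_arg_max len (\<lambda>\<tau>. \<tau> \<in> C) \<sigma>"
      unfolding is_arg_max_def by (metis not_less_iff_gr_or_eq)
  qed
  then show ?thesis
    unfolding classes_with_unique_longest_def classes_with_bruhat_maximum_def by blast
qed

end
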